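(* Let $0<p<\infty$, $\lambda_1,\lambda_2\in\mathbb{R}$ and $\beta>-n$. Then the following holds. (a) If $\lambda_1+\lambda_2(1+\beta/n)>0$ and $0< \lambda_1+\lambda_2< n$, then $$\|f\|_{\mathcal L^{p,(\lambda_1,\lambda_2)}(|x|^\beta)}\sim \|f\|_{\mathcal L^{p,(\lambda_1+\lambda_2,0)}(|x|^{\beta(1-\lambda_2/n)})}.$$ (b) If $\lambda_1+\lambda_2(1+\beta/n)=0$ and $0\le \lambda_1+\lambda_2< n$, then $$\|f\|_{\mathcal L^{p,(\lambda_1,\lambda_2)}(|x|^\beta)}\sim \|f\|_{L^{p}(|x|^\beta)}+ \|f\|_{\mathcal L^{p,(\lambda_1+\lambda_2,0)}(|x|^{\beta+\lambda_1+\lambda_2})}.$$ (c) If $\lambda_1+\lambda_2(1+\beta/n)<0$, then $\mathcal L^{p,(\lambda_1,\lambda_2)}(|x|^\beta)=\{0\}$. (d) If $n=\lambda_1+\lambda_2>-\lambda_2\beta/n$, then $$\mathcal L^{p,(\lambda_1,\lambda_2)}(|x|^\beta)=\{f: |f|^p |x|^{\beta(1-\lambda_2/n)}\in L^\infty\}.$$ In (a) and (b), $\sim$ means equivalence with constants independent of the measurable function $f$.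
   Context: For a nonnegative function $w$ on $\mathbb{R}^n$, $w(E)=\int_E w$. For $0<p<\infty$ and $\lambda=(\lambda_1,\lambda_2)\in\mathbb{R}^2$, the weighted Morrey space $\mathcal L^{p,\lambda}(w)$ is the set of measurable functions $f$ on $\mathbb{R}^n$ (identified when equal a.e.) with $$\|f\|_{\mathcal L^{p,\lambda}(w)} := \sup_{x\in \mathbb{R}^n,\, r>0}\left(\frac 1{r^{\lambda_1}\, w(B(x,r))^{\lambda_2/n}}\int_{B(x,r)}|f|^p w\right)^{1/p}<\infty,$$ where $B(x,r)$ is the Euclidean ball. When $\lambda_2=0$ the factor $w(B(x,r))^{\lambda_2/n}$ is absent (equal to $1$). $|x|^\gamma$ denotes the power weight $x\mapsto|x|^\gamma$, and $\|f\|_{L^p(w)}=(\int_{\mathbb{R}^n}|f|^pw)^{1/p}$. *)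

theory Defs
  imports "HOL-Probability.Essential_Supremum"
begin

text \<open>Real powers on \<open>[0,\<infinity>]\<close>, with the usual conventions for \<open>0\<close> and \<open>\<infinity>\<close>. The exponent
  \<open>0\<close> always gives \<open>1\<close> (also \<open>0\<^sup>0 = \<infinity>\<^sup>0 = 1\<close>); thus the factor \<open>w(B)\<close> in the Morrey
  norm is absent when its exponent is \<open>0\<close>, even when \<open>w\<close> is not locally integrable.\<close>

definition epowr :: "ennreal \<Rightarrow> real \<Rightarrow> ennreal" where
  "epowr x a =
    (if a = 0 then 1
     else if x = 0 then (if 0 < a then 0 else \<infinity>)
     else if x = \<infinity> then (if 0 < a then \<infinity> else 0)
     else ennreal (enn2real x powr a))"

text \<open>At the origin \<open>powr\<close> returns \<open>0\<close> whatever the exponent; this is a null set.\<close>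

definition power_weight :: "real \<Rightarrow> real ^ 'n \<Rightarrow> real" where
  "power_weight \<gamma> x = norm x powr \<gamma>"

definition weight_measure :: "(real ^ 'n \<Rightarrow> real) \<Rightarrow> (real ^ 'n) set \<Rightarrow> ennreal" where
  "weight_measure w E = (\<integral>\<^sup>+ y \<in> E. ennreal (w y) \<partial>lebesgue)"

definition weighted_Lp_norm ::
  "real \<Rightarrow> (real ^ 'n \<Rightarrow> real) \<Rightarrow> (real ^ 'n \<Rightarrow> complex) \<Rightarrow> ennreal" where
  "weighted_Lp_norm p w f =
    epowr (\<integral>\<^sup>+ y. ennreal (norm (f y) powr p * w y) \<partial>lebesgue) (1 / p)"

definition morrey_norm ::
  "real \<Rightarrow> real \<times> real \<Rightarrow> (real ^ 'n \<Rightarrow> real) \<Rightarrow> (real ^ 'n \<Rightarrow> complex) \<Rightarrow> ennreal" where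
  "morrey_norm p l w f =
    (SUP (x, r) \<in> UNIV \<times> {0<..}.
      epowr ((\<integral>\<^sup>+ y \<in> ball x r. ennreal (norm (f y) powr p * w y) \<partial>lebesgue) /
             (ennreal (r powr fst l) *
              epowr (weight_measure w (ball x r)) (snd l / real CARD('n))))
        (1 / p))"

text \<open>The class of \<open>f\<close> modulo equality almost everywhere.\<close>

definition ae_class :: "(real ^ 'n \<Rightarrow> complex) \<Rightarrow> (real ^ 'n \<Rightarrow> complex) set" where
  "ae_class f = {g \<in> borel_measurable lebesgue. AE x in lebesgue. g x = f x}"

definition morrey_space ::
  "real \<Rightarrow> real \<times> real \<Rightarrow> (real ^ 'n \<Rightarrow> real) \<Rightarrow> (real ^ 'n \<Rightarrow> complex) set set" where
  "morrey_space p l w =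
    ae_class ` {f \<in> borel_measurable lebesgue. morrey_norm p l w f < \<infinity>}"

definition Linfty :: "(real ^ 'n \<Rightarrow> real) set" where
  "Linfty = {g \<in> borel_measurable lebesgue. esssup lebesgue (\<lambda>x. ennreal \<bar>g x\<bar>) < \<infinity>}"

text \<open>Equivalence of \<open>[0,\<infinity>]\<close>-valued functionals; in particular they are infinite for the same
  measurable functions.\<close>

definition equivalent_norms ::
  "((real ^ 'n \<Rightarrow> complex) \<Rightarrow> ennreal) \<Rightarrow> ((real ^ 'n \<Rightarrow> complex) \<Rightarrow> ennreal) \<Rightarrow> bool" where
  "equivalent_norms N M \<longleftrightarrow>
    (\<exists>c C :: real. 0 < c \<and> 0 < C \<and>
      (\<forall>f \<in> borel_measurable lebesgue.
        ennreal c * M f \<le> N f \<and> N f \<le> ennreal C * M f))"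

end

theory Submission
  imports Defs
begin

text \<open>
  Write \<open>\<lambda> = \<lambda>\<^sub>1 + \<lambda>\<^sub>2\<close> and \<open>\<epsilon> = \<beta>\<lambda>\<^sub>2/n\<close>. The normalising factor
  \<open>r\<^bsup>\<lambda>\<^sub>1\<^esup> w(B(x,r))\<^bsup>\<lambda>\<^sub>2/n\<^esup>\<close> is comparable to \<open>r\<^bsup>\<lambda>\<^esup> |x|\<^bsup>\<epsilon>\<^esup>\<close> on balls that stay away from the
  origin (\<open>2r \<le> |x|\<close>) and to \<open>r\<^bsup>\<lambda>+\<epsilon>\<^esup>\<close> on the others. On the former \<open>|y|\<close> is essentially
  constant, so powers of it move freely between the weight and the normalisation. The latter can be
  replaced by balls centred at \<open>0\<close>; decomposing these dyadically, multiplying the weight by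
  \<open>|y|\<^bsup>\<tau>\<^esup>\<close> costs a geometric series that converges when the resulting total exponent of \<open>r\<close> is
  positive. Taking \<open>\<tau> = \<plusminus>\<epsilon>\<close> gives (a), and \<open>\<tau> = \<beta>\<close> with a constant integrand gives the
  comparison for \<open>w(B)\<close> itself. If \<open>\<lambda> + \<epsilon> = 0\<close>, the large balls see exactly the \<open>L\<^sup>p\<close> norm; if
  \<open>\<lambda> + \<epsilon> < 0\<close>, letting \<open>r \<rightarrow> \<infinity>\<close> kills \<open>f\<close>. For \<open>\<lambda> = n\<close> the averages of
  \<open>|f|\<^sup>p |y|\<^bsup>\<beta>-\<epsilon>\<^esup>\<close> over balls are bounded, and Vitali's covering theorem turns this into an
  essential bound.
\<close>

section \<open>Dyadic decomposition at the origin\<close>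

text \<open>For \<open>\<tau> \<ge> 0\<close> the bound \<open>a \<le> c * b\<close> is the relevant
  one, for \<open>\<tau> < 0\<close> it is \<open>b \<le> c * a\<close>. Asking for both, and paying
  \<open>\<bar>\<tau>\<bar>\<close> in the exponent, spares later arguments any distinction of
  signs.\<close>

lemma powr_le_powr_comparable:
  fixes a b c \<tau> :: real
  assumes "0 < a" "0 < b" "0 < c" "a \<le> c * b" "b \<le> c * a"
  shows "a powr \<tau> \<le> c powr \<bar>\<tau>\<bar> * b powr \<tau>"
proof (cases "0 \<le> \<tau>")
  case True
  have "a powr \<tau> \<le> (c * b) powr \<tau>"
    using assms True by (intro powr_mono2) auto
  then show ?thesis using True assms by (simp add: powr_mult)
next
  case False
  have "b / c \<le> a" using assms by (simp add: field_simps)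
  then have "a powr \<tau> \<le> (b / c) powr \<tau>"
    using assms False by (intro powr_mono2') auto
  also have "\<dots> = c powr \<bar>\<tau>\<bar> * b powr \<tau>"
    using assms False by (simp add: powr_divide powr_minus field_simps)
  finally show ?thesis .
qed

lemma exists_dyadic_shell:
  fixes t \<rho> :: real
  assumes "0 < t" "t < \<rho>"
  obtains k :: nat where "t < \<rho> / 2 ^ k" "\<rho> / 2 ^ k \<le> 2 * t"
proof -
  have "\<exists>k. \<rho> / 2 ^ k \<le> t"
  proof -
    obtain k where "\<rho> / t < 2 ^ k" using real_arch_pow[of 2 "\<rho> / t"] by auto
    then have "\<rho> / 2 ^ k \<le> t" using assms by (simp add: field_simps)
    then show ?thesis ..
  qed
  then have k: "\<rho> / 2 ^ (LEAST k. \<rho> / 2 ^ k \<le> t) \<le> t" by (rule LeastI_ex)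
  define m where "m = (LEAST k. \<rho> / 2 ^ k \<le> t)"
  \<comment> \<open>At index 0 the radius is \<open>\<rho>\<close>, still above \<open>t\<close>. So
    the first radius not exceeding \<open>t\<close> has a predecessor, which is the shell
    sought.\<close>
  have "m \<noteq> 0" using k assms unfolding m_def[symmetric] by (cases m) auto
  then obtain j where j: "m = Suc j" by (cases m) auto
  have "\<not> \<rho> / 2 ^ j \<le> t" using not_less_Least[of j "\<lambda>k. \<rho> / 2 ^ k \<le> t"] j m_def by auto
  moreover have "\<rho> / 2 ^ j \<le> 2 * t" using k unfolding m_def[symmetric] j by (simp add: field_simps)
  ultimately show ?thesis using that[of j] by auto
qed

lemma sets_lebesgue_ball [measurable, simp]: "ball (x::'a::euclidean_space) r \<in> sets lebesgue"
  by (simp add: sets_completionI_sets)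

lemma measurable_norm_powr [measurable]:
  "(\<lambda>y::'a::euclidean_space. norm y powr \<gamma>) \<in> borel_measurable lebesgue"
  by (rule measurable_completion) measurable

text \<open>A nonzero point of the ball lies in a shell where its norm is comparable to
  \<open>\<rho> / 2 ^ k\<close>, so a single term dominates. Full balls replace shells since
  hypotheses will only control balls. At the origin the left side is 0 by the convention for
  \<open>powr\<close>.\<close>

lemma norm_powr_le_dyadic_sum:
  fixes y :: "'a::real_normed_vector"
  shows "ennreal (norm y powr \<tau>) * indicator (ball 0 \<rho>) y
    \<le> (\<Sum>k. ennreal (2 powr \<bar>\<tau>\<bar> * (\<rho> / 2 ^ k) powr \<tau>) * indicator (ball 0 (\<rho> / 2 ^ k)) y)"
    (is "_ \<le> (\<Sum>k. ?t k)")
proof (cases "y \<noteq> 0 \<and> norm y < \<rho>")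
  case True
  then obtain k :: nat where k: "norm y < \<rho> / 2 ^ k" "\<rho> / 2 ^ k \<le> 2 * norm y"
    using exists_dyadic_shell[of "norm y" \<rho>] by auto
  have "norm y powr \<tau> \<le> 2 powr \<bar>\<tau>\<bar> * (\<rho> / 2 ^ k) powr \<tau>"
    using k True by (intro powr_le_powr_comparable) (auto simp: zero_less_divide_iff)
  then have "ennreal (norm y powr \<tau>) * indicator (ball 0 \<rho>) y \<le> ?t k"
    using k True by (auto intro!: ennreal_leI)
  also have "\<dots> \<le> (\<Sum>k. ?t k)"
    using sum_le_suminf[OF summableI, of "{k}" ?t] by (simp del: sum_mult_indicator)
  finally show ?thesis .
qed auto

text \<open>The k-th dyadic ball contributes a multiple of
  \<open>(\<rho> / 2 ^ k) powr (s + \<tau>)\<close>. These terms form a geometric series of ratio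
  \<open>2 powr - (s + \<tau>)\<close>, so only the sign of \<open>s + \<tau>\<close> matters and
  \<open>s\<close> itself may be negative.\<close>

lemma centred_ball_integral_le:
  fixes h :: "'a::euclidean_space \<Rightarrow> ennreal"
  assumes [measurable]: "h \<in> borel_measurable lebesgue"
    and bound: "\<And>\<rho>. 0 < \<rho> \<Longrightarrow> (\<integral>\<^sup>+ y \<in> ball 0 \<rho>. h y \<partial>lebesgue) \<le> ennreal (\<rho> powr s) * T"
    and pos: "0 < s + \<tau>" and \<rho>: "0 < \<rho>"
  shows "(\<integral>\<^sup>+ y \<in> ball 0 \<rho>. h y * ennreal (norm y powr \<tau>) \<partial>lebesgue)
    \<le> ennreal (2 powr \<bar>\<tau>\<bar> / (1 - 2 powr - (s + \<tau>)) * \<rho> powr (s + \<tau>)) * T"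
proof -
  let ?c = "\<lambda>k::nat. 2 powr \<bar>\<tau>\<bar> * (\<rho> / 2 ^ k) powr \<tau>"
  let ?q = "2 powr - (s + \<tau>) :: real"
  have q: "0 < ?q" "?q < 1" using pos powr_less_mono[of "-(s+\<tau>)" 0 "2::real"] by auto
  have "(\<integral>\<^sup>+ y \<in> ball 0 \<rho>. h y * ennreal (norm y powr \<tau>) \<partial>lebesgue)
     \<le> (\<integral>\<^sup>+ y. h y * (\<Sum>k. ennreal (?c k) * indicator (ball 0 (\<rho> / 2 ^ k)) y) \<partial>lebesgue)"
    by (intro nn_integral_mono) (auto simp: mult.assoc intro!: mult_left_mono norm_powr_le_dyadic_sum)
  also have "\<dots> = (\<integral>\<^sup>+ y. (\<Sum>k. ennreal (?c k) * (h y * indicator (ball 0 (\<rho> / 2 ^ k)) y)) \<partial>lebesgue)"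
    by (simp add: mult_ac flip: ennreal_suminf_cmult)
  also have "\<dots> = (\<Sum>k. \<integral>\<^sup>+ y. ennreal (?c k) * (h y * indicator (ball 0 (\<rho> / 2 ^ k)) y) \<partial>lebesgue)"
    by (intro nn_integral_suminf) measurable
  also have "\<dots> = (\<Sum>k. ennreal (?c k) * (\<integral>\<^sup>+ y \<in> ball 0 (\<rho> / 2 ^ k). h y \<partial>lebesgue))"
    by (simp add: nn_integral_cmult)
  also have "\<dots> \<le> (\<Sum>k. ennreal (?c k) * (ennreal ((\<rho> / 2 ^ k) powr s) * T))"
    using \<rho> by (intro suminf_le mult_left_mono bound) auto
  also have "\<dots> = (\<Sum>k. ennreal (2 powr \<bar>\<tau>\<bar> * \<rho> powr (s + \<tau>) * ?q ^ k) * T)"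
  proof -
    have "?c k * (\<rho> / 2 ^ k) powr s = 2 powr \<bar>\<tau>\<bar> * \<rho> powr (s + \<tau>) * ?q ^ k" for k
    proof -
      have "?q ^ k = (2 ^ k) powr - (s + \<tau>)"
        by (simp add: powr_powr mult.commute flip: powr_realpow)
      moreover have "(\<rho> / 2 ^ k) powr \<tau> * (\<rho> / 2 ^ k) powr s = (\<rho> / 2 ^ k) powr (s + \<tau>)"
        by (simp add: powr_add)
      moreover have "(\<rho> / 2 ^ k) powr (s + \<tau>) = \<rho> powr (s + \<tau>) * (2 ^ k) powr - (s + \<tau>)"
        using \<rho> powr_divide[of \<rho> "2 ^ k" "s + \<tau>"] by (simp only: powr_minus divide_inverse)
      ultimately show ?thesis by (simp only: mult.assoc)
    qed
    then have "ennreal (?c k) * (ennreal ((\<rho> / 2 ^ k) powr s) * T)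
        = ennreal (2 powr \<bar>\<tau>\<bar> * \<rho> powr (s + \<tau>) * ?q ^ k) * T" for k
      by (metis ennreal_mult mult.assoc mult_nonneg_nonneg powr_ge_zero)
    then show ?thesis by (simp only:)
  qed
  also have "\<dots> = ennreal (2 powr \<bar>\<tau>\<bar> / (1 - ?q) * \<rho> powr (s + \<tau>)) * T"
  proof -
    have "(\<lambda>k. 2 powr \<bar>\<tau>\<bar> * \<rho> powr (s + \<tau>) * ?q ^ k) sums
        (2 powr \<bar>\<tau>\<bar> * \<rho> powr (s + \<tau>) * (1 / (1 - ?q)))"
      using q by (intro sums_mult geometric_sums) simp
    then have "(\<Sum>k. ennreal (2 powr \<bar>\<tau>\<bar> * \<rho> powr (s + \<tau>) * ?q ^ k))
        = ennreal (2 powr \<bar>\<tau>\<bar> * \<rho> powr (s + \<tau>) * (1 / (1 - ?q)))"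
      by (intro suminf_ennreal_eq) simp_all
    then show ?thesis by simp
  qed
  finally show ?thesis .
qed

text \<open>The model for \<open>r\<^bsup>\<lambda>\<^sub>1\<^esup> w(B(x,r))\<^bsup>\<lambda>\<^sub>2/n\<^esup>\<close> up to constants, with \<open>l = \<lambda>\<^sub>1 + \<lambda>\<^sub>2\<close> and
  \<open>\<epsilon> = \<beta>\<lambda>\<^sub>2/n\<close>.\<close>

definition ball_scale :: "real \<Rightarrow> real \<Rightarrow> 'a::real_normed_vector \<Rightarrow> real \<Rightarrow> real" where
  "ball_scale l \<epsilon> x r =
    (if 2 * r \<le> norm x then r powr l * norm x powr \<epsilon> else r powr (l + \<epsilon>))"

lemma ball_scale_pos: "0 < r \<Longrightarrow> 0 < ball_scale l \<epsilon> x r"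
  by (auto simp: ball_scale_def intro!: mult_pos_pos)

text \<open>On such a ball \<open>norm y\<close> lies between half and twice \<open>norm x\<close>,
  so the power is essentially constant there, whatever the sign of \<open>\<tau>\<close>.\<close>

lemma small_ball_integral_le:
  fixes h :: "'a::euclidean_space \<Rightarrow> ennreal"
  assumes [measurable]: "h \<in> borel_measurable lebesgue" and r: "0 < r" "2 * r \<le> norm x"
  shows "(\<integral>\<^sup>+ y \<in> ball x r. h y * ennreal (norm y powr \<tau>) \<partial>lebesgue)
    \<le> ennreal (2 powr \<bar>\<tau>\<bar> * norm x powr \<tau>) * (\<integral>\<^sup>+ y \<in> ball x r. h y \<partial>lebesgue)"
proof -
  have *: "norm y powr \<tau> \<le> 2 powr \<bar>\<tau>\<bar> * norm x powr \<tau>" if "y \<in> ball x r" for y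
  proof -
    have "norm x - norm y \<le> norm (x - y)" "norm y - norm x \<le> norm (x - y)" "norm (x - y) < r"
      using that norm_triangle_ineq2[of x y] norm_triangle_ineq2[of y x]
      by (auto simp: dist_norm norm_minus_commute)
    then have "0 < norm y" "norm y \<le> 2 * norm x" "norm x \<le> 2 * norm y" "0 < norm x"
      using r by linarith+
    then show ?thesis by (intro powr_le_powr_comparable) auto
  qed
  have "(\<integral>\<^sup>+ y \<in> ball x r. h y * ennreal (norm y powr \<tau>) \<partial>lebesgue)
    \<le> (\<integral>\<^sup>+ y. ennreal (2 powr \<bar>\<tau>\<bar> * norm x powr \<tau>) * (h y * indicator (ball x r) y) \<partial>lebesgue)"
    using * by (intro nn_integral_mono)
      (auto simp: indicator_def mult.commute[of "h _"] intro!: mult_right_mono ennreal_leI)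
  also have "\<dots> = ennreal (2 powr \<bar>\<tau>\<bar> * norm x powr \<tau>) * (\<integral>\<^sup>+ y \<in> ball x r. h y \<partial>lebesgue)"
    by (intro nn_integral_cmult) measurable
  finally show ?thesis .
qed

text \<open>The engine of all comparisons: multiplying the integrand by a power
  \<open>\<tau>\<close> of the norm shifts \<open>\<epsilon>\<close> by \<open>\<tau>\<close> and
  keeps \<open>l\<close>. Balls away from the origin allow this for every \<open>\<tau>\<close>;
  only balls near it need the positive total exponent. The constant is chosen before
  \<open>h\<close> and \<open>T\<close>.\<close>

lemma ball_scale_transfer:
  fixes l \<epsilon> \<tau> :: real
  assumes "0 < l + \<epsilon> + \<tau>"
  obtains C where "0 < C"
    "\<And>(h :: 'a::euclidean_space \<Rightarrow> ennreal) T x r.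
       h \<in> borel_measurable lebesgue \<Longrightarrow>
       (\<And>x r. 0 < r \<Longrightarrow> (\<integral>\<^sup>+ y \<in> ball x r. h y \<partial>lebesgue) \<le> ennreal (ball_scale l \<epsilon> x r) * T) \<Longrightarrow>
       0 < r \<Longrightarrow>
       (\<integral>\<^sup>+ y \<in> ball x r. h y * ennreal (norm y powr \<tau>) \<partial>lebesgue)
         \<le> ennreal (C * ball_scale l (\<epsilon> + \<tau>) x r) * T"
proof -
  \<comment> \<open>\<open>A\<close> serves balls near the origin: the sum of the geometric series,
    times the cost of tripling the radius. The other entry of the maximum serves distant
    balls.\<close>
  define A where "A = 2 powr \<bar>\<tau>\<bar> / (1 - 2 powr - (l + \<epsilon> + \<tau>)) * 3 powr (l + \<epsilon> + \<tau>)"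
  define C where "C = max A (2 powr \<bar>\<tau>\<bar>)"
  show ?thesis
  proof (rule that[of C])
    show "0 < C" by (simp add: C_def less_max_iff_disj)
    fix h :: "'a \<Rightarrow> ennreal" and T x and r :: real
    assume h [measurable]: "h \<in> borel_measurable lebesgue"
      and bound: "\<And>x r. 0 < r \<Longrightarrow> (\<integral>\<^sup>+ y \<in> ball x r. h y \<partial>lebesgue) \<le> ennreal (ball_scale l \<epsilon> x r) * T"
      and r: "0 < r"
    let ?I = "\<integral>\<^sup>+ y \<in> ball x r. h y * ennreal (norm y powr \<tau>) \<partial>lebesgue"
    show "?I \<le> ennreal (C * ball_scale l (\<epsilon> + \<tau>) x r) * T"
    proof (cases "2 * r \<le> norm x")
      case True
      have "?I \<le> ennreal (2 powr \<bar>\<tau>\<bar> * norm x powr \<tau>) * (ennreal (ball_scale l \<epsilon> x r) * T)"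
        using small_ball_integral_le[OF h r True, of \<tau>] bound[OF r, of x]
        by (meson mult_left_mono order_trans zero_le)
      also have "\<dots> = ennreal (2 powr \<bar>\<tau>\<bar> * ball_scale l (\<epsilon> + \<tau>) x r) * T"
      proof -
        have "2 powr \<bar>\<tau>\<bar> * norm x powr \<tau> * ball_scale l \<epsilon> x r = 2 powr \<bar>\<tau>\<bar> * ball_scale l (\<epsilon> + \<tau>) x r"
          using True by (simp add: ball_scale_def powr_add)
        then show ?thesis
          using ball_scale_pos[OF r, of l \<epsilon> x]
          by (metis ennreal_mult less_imp_le mult.assoc mult_nonneg_nonneg powr_ge_zero)
      qed
      also have "\<dots> \<le> ennreal (C * ball_scale l (\<epsilon> + \<tau>) x r) * T"
        using ball_scale_pos[OF r, of l "\<epsilon> + \<tau>" x]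
        by (intro mult_right_mono ennreal_leI) (auto simp: C_def)
      finally show ?thesis .
    next
      case False
      have "ball x r \<subseteq> ball 0 (3 * r)"
      proof
        fix y assume "y \<in> ball x r"
        then show "y \<in> ball 0 (3 * r)"
          using norm_triangle_ineq2[of y x] False by (auto simp: dist_norm norm_minus_commute)
      qed
      then have "?I \<le> (\<integral>\<^sup>+ y \<in> ball 0 (3 * r). h y * ennreal (norm y powr \<tau>) \<partial>lebesgue)"
        by (intro nn_integral_mono mult_left_mono) (auto simp: indicator_def)
      also have "\<dots> \<le> ennreal (2 powr \<bar>\<tau>\<bar> / (1 - 2 powr - (l + \<epsilon> + \<tau>)) * (3 * r) powr (l + \<epsilon> + \<tau>)) * T"
        using r assms bound[of _ 0] by (intro centred_ball_integral_le h) (auto simp: ball_scale_def)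
      also have "\<dots> = ennreal (A * ball_scale l (\<epsilon> + \<tau>) x r) * T"
        using False r by (simp add: A_def ball_scale_def powr_mult add.assoc mult_ac)
      also have "\<dots> \<le> ennreal (C * ball_scale l (\<epsilon> + \<tau>) x r) * T"
        using ball_scale_pos[OF r, of l "\<epsilon> + \<tau>" x]
        by (intro mult_right_mono ennreal_leI) (auto simp: C_def)
      finally show ?thesis .
    qed
  qed
qed

section \<open>The Morrey norm as a bound on ball integrals\<close>

lemma epowr_mono: "0 < a \<Longrightarrow> x \<le> y \<Longrightarrow> epowr x a \<le> epowr y a"
  by (cases x; cases y)
     (auto simp: epowr_def top_unique infinity_ennreal_def intro!: ennreal_leI powr_mono2)

lemma epowr_ennreal: "0 < x \<Longrightarrow> epowr (ennreal x) a = ennreal (x powr a)"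
  by (auto simp: epowr_def ennreal_eq_0_iff)

lemma epowr_epowr_inverse: "0 < a \<Longrightarrow> epowr (epowr x a) (1 / a) = x"
proof (cases x)
  case (real t)
  then show "0 < a \<Longrightarrow> epowr (epowr x a) (1 / a) = x"
    by (cases "t = 0") (auto simp: epowr_ennreal powr_powr epowr_def[of 0])
qed (auto simp: epowr_def infinity_ennreal_def)

lemma epowr_inverse_epowr: "0 < a \<Longrightarrow> epowr (epowr x (1 / a)) a = x"
  using epowr_epowr_inverse[of "1 / a" x] by simp

lemma epowr_cmult:
  "0 < a \<Longrightarrow> 0 < c \<Longrightarrow> epowr (ennreal c * x) a = ennreal (c powr a) * epowr x a"
proof (cases x)
  case (real t)
  then show "0 < a \<Longrightarrow> 0 < c \<Longrightarrow> epowr (ennreal c * x) a = ennreal (c powr a) * epowr x a"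
    by (cases "t = 0")
      (auto simp: epowr_ennreal powr_mult epowr_def[of 0] simp flip: ennreal_mult)
qed (auto simp: epowr_def infinity_ennreal_def ennreal_mult_top)

lemma epowr_less_top: "0 < a \<Longrightarrow> x < \<infinity> \<Longrightarrow> epowr x a < \<infinity>"
  by (auto simp: epowr_def infinity_ennreal_def)

definition morrey_factor ::
  "real \<times> real \<Rightarrow> (real ^ 'n \<Rightarrow> real) \<Rightarrow> real ^ 'n \<Rightarrow> real \<Rightarrow> ennreal" where
  "morrey_factor l w x r =
    ennreal (r powr fst l) * epowr (weight_measure w (ball x r)) (snd l / real CARD('n))"

text \<open>Finiteness and positivity of the factor are part of the notion, so that dividing by it
  in \<open>[0,\<infinity>]\<close> is reversible. Afterwards only \<open>m\<close> and
  \<open>\<epsilon>\<close> have to be remembered.\<close>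

definition scales_like :: "real \<times> real \<Rightarrow> (real ^ 'n \<Rightarrow> real) \<Rightarrow> real \<Rightarrow> real \<Rightarrow> bool" where
  "scales_like l w m \<epsilon> \<longleftrightarrow>
    (\<exists>c>0. \<forall>x r. 0 < r \<longrightarrow> (\<exists>d>0. morrey_factor l w x r = ennreal d \<and>
       d \<le> c * ball_scale m \<epsilon> x r \<and> ball_scale m \<epsilon> x r \<le> c * d))"

text \<open>A bound on the Morrey norm with the p-th root and the division removed; \<open>T\<close>
  stands for the p-th power of the norm up to a constant, and may be infinite.\<close>

definition morrey_bound ::
  "real \<Rightarrow> (real ^ 'n \<Rightarrow> real) \<Rightarrow> (real ^ 'n \<Rightarrow> complex) \<Rightarrow> real \<Rightarrow> real \<Rightarrow> ennreal \<Rightarrow> bool" where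
  "morrey_bound p w f m \<epsilon> T \<longleftrightarrow>
    (\<forall>x r. 0 < r \<longrightarrow>
      (\<integral>\<^sup>+ y \<in> ball x r. ennreal (norm (f y) powr p * w y) \<partial>lebesgue)
        \<le> ennreal (ball_scale m \<epsilon> x r) * T)"

lemma ennreal_divide_le_iff:
  assumes "0 < d" shows "(a::ennreal) / ennreal d \<le> b \<longleftrightarrow> a \<le> ennreal d * b"
proof
  assume "a / ennreal d \<le> b"
  then have "ennreal d * (a / ennreal d) \<le> ennreal d * b" by (rule mult_left_mono) simp
  also have "ennreal d * (a / ennreal d) = a"
    using assms by (simp add: ennreal_times_divide ennreal_mult_divide_eq mult.commute[of "ennreal d"])
  finally show "a \<le> ennreal d * b" .
qed (use assms in \<open>intro divide_le_posI_ennreal, auto simp: mult.commute\<close>)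

text \<open>The p-th root is an order isomorphism of \<open>[0,\<infinity>]\<close>, so it can be
  cancelled ball by ball under the supremum.\<close>

lemma morrey_norm_le_iff:
  assumes "0 < p"
  shows "morrey_norm p l w f \<le> epowr T (1 / p) \<longleftrightarrow>
    (\<forall>x r. 0 < r \<longrightarrow>
      (\<integral>\<^sup>+ y \<in> ball x r. ennreal (norm (f y) powr p * w y) \<partial>lebesgue) / morrey_factor l w x r \<le> T)"
proof -
  have "epowr q (1 / p) \<le> epowr T (1 / p) \<longleftrightarrow> q \<le> T" for q
    using assms epowr_mono[of p "epowr q (1 / p)" "epowr T (1 / p)"] epowr_mono[of "1 / p" q T]
    by (auto simp: epowr_inverse_epowr)
  then show ?thesis
    by (auto simp: morrey_norm_def SUP_le_iff morrey_factor_def)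
qed

text \<open>The p-th power of the norm is itself an admissible bound for the exact factor; replacing
  that factor by the model costs a constant chosen before \<open>f\<close>.\<close>

lemma morrey_bound_of_norm:
  assumes "scales_like l w m \<epsilon>" "0 < p"
  obtains C where "0 < C" "\<And>f. morrey_bound p w f m \<epsilon> (ennreal C * epowr (morrey_norm p l w f) p)"
proof -
  obtain c where c: "0 < c" and d: "\<And>x r. 0 < r \<Longrightarrow> \<exists>d>0. morrey_factor l w x r = ennreal d \<and>
       d \<le> c * ball_scale m \<epsilon> x r \<and> ball_scale m \<epsilon> x r \<le> c * d"
    using assms(1) unfolding scales_like_def by blast
  have "morrey_bound p w f m \<epsilon> (ennreal c * epowr (morrey_norm p l w f) p)" for f
    unfolding morrey_bound_def
  proof (intro allI impI)
    fix x :: "real ^ 'a" and r :: real assume r: "0 < r"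
    obtain d where d: "0 < d" "morrey_factor l w x r = ennreal d" "d \<le> c * ball_scale m \<epsilon> x r"
      using d[OF r] by blast
    let ?N = "epowr (morrey_norm p l w f) p"
    have "(\<integral>\<^sup>+ y \<in> ball x r. ennreal (norm (f y) powr p * w y) \<partial>lebesgue) / ennreal d \<le> ?N"
      using morrey_norm_le_iff[OF assms(2), of l w f ?N] assms(2) r
      by (simp add: epowr_epowr_inverse flip: d(2))
    then have "(\<integral>\<^sup>+ y \<in> ball x r. ennreal (norm (f y) powr p * w y) \<partial>lebesgue) \<le> ennreal d * ?N"
      using d(1) by (simp add: ennreal_divide_le_iff)
    also have "\<dots> \<le> ennreal (c * ball_scale m \<epsilon> x r) * ?N"
      using d(3) by (intro mult_right_mono ennreal_leI) auto
    also have "\<dots> = ennreal (ball_scale m \<epsilon> x r) * (ennreal c * ?N)"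
      using c by (simp add: ennreal_mult' mult_ac)
    finally show "(\<integral>\<^sup>+ y \<in> ball x r. ennreal (norm (f y) powr p * w y) \<partial>lebesgue)
        \<le> ennreal (ball_scale m \<epsilon> x r) * (ennreal c * ?N)" .
  qed
  then show ?thesis using that c by blast
qed

lemma norm_le_of_morrey_bound:
  assumes "scales_like l w m \<epsilon>" "0 < p"
  obtains C where "0 < C"
    "\<And>f T. morrey_bound p w f m \<epsilon> T \<Longrightarrow> morrey_norm p l w f \<le> ennreal C * epowr T (1 / p)"
proof -
  obtain c where c: "0 < c" and d: "\<And>x r. 0 < r \<Longrightarrow> \<exists>d>0. morrey_factor l w x r = ennreal d \<and>
       d \<le> c * ball_scale m \<epsilon> x r \<and> ball_scale m \<epsilon> x r \<le> c * d"
    using assms(1) unfolding scales_like_def by blast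
  have "morrey_norm p l w f \<le> ennreal (c powr (1 / p)) * epowr T (1 / p)"
    if T: "morrey_bound p w f m \<epsilon> T" for f T
  proof -
    have "morrey_norm p l w f \<le> epowr (ennreal c * T) (1 / p)"
      unfolding morrey_norm_le_iff[OF assms(2)]
    proof (intro allI impI)
      fix x :: "real ^ 'a" and r :: real assume r: "0 < r"
      obtain d where d: "0 < d" "morrey_factor l w x r = ennreal d" "ball_scale m \<epsilon> x r \<le> c * d"
        using d[OF r] by blast
      have "(\<integral>\<^sup>+ y \<in> ball x r. ennreal (norm (f y) powr p * w y) \<partial>lebesgue)
          \<le> ennreal (ball_scale m \<epsilon> x r) * T"
        using T r by (simp add: morrey_bound_def)
      also have "\<dots> \<le> ennreal (c * d) * T"
        using d by (intro mult_right_mono ennreal_leI) auto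
      also have "\<dots> = ennreal d * (ennreal c * T)"
        using c d by (simp add: ennreal_mult' mult_ac)
      finally show "(\<integral>\<^sup>+ y \<in> ball x r. ennreal (norm (f y) powr p * w y) \<partial>lebesgue)
          / morrey_factor l w x r \<le> ennreal c * T"
        using d by (simp add: ennreal_divide_le_iff)
    qed
    then show ?thesis using assms(2) c by (simp add: epowr_cmult)
  qed
  then show ?thesis using that[of "c powr (1 / p)"] c by simp
qed

section \<open>The measure of balls for power weights\<close>

text \<open>Supplies the lower bound for the weight of a ball. Far from the origin the concentric
  ball works; near it the centre is pushed outwards by \<open>r / 2\<close>, so that the norm stays
  comparable to \<open>r\<close>.\<close>

lemma exists_comparable_subball:
  fixes x :: "'a::euclidean_space"
  assumes r: "0 < r"
  obtains z where "ball z (r / 4) \<subseteq> ball x r"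
    "\<And>y. y \<in> ball z (r / 4) \<Longrightarrow> norm y \<le> 4 * (if 2 * r \<le> norm x then norm x else r) \<and>
       (if 2 * r \<le> norm x then norm x else r) \<le> 4 * norm y"
proof (cases "2 * r \<le> norm x")
  case True
  have "norm y \<le> 4 * norm x \<and> norm x \<le> 4 * norm y" if "y \<in> ball x (r / 4)" for y
    using that norm_triangle_ineq2[of x y] norm_triangle_ineq2[of y x] r True
    by (auto simp: dist_norm norm_minus_commute)
  moreover have "ball x (r / 4) \<subseteq> ball x r" using r by (intro subset_ball) simp
  ultimately show ?thesis using that[of x] True by simp
next
  case False
  \<comment> \<open>The outward direction at \<open>x\<close>; at the origin any unit vector will
    do.\<close>
  obtain u where u: "norm u = 1" "x = norm x *\<^sub>R u"
  proof (cases "x = 0")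
    case True
    obtain v :: 'a where "norm v = 1" using vector_choose_size[of 1] by auto
    then show ?thesis using that[of v] True by simp
  qed (use that[of "sgn x"] in \<open>auto simp: norm_sgn sgn_div_norm\<close>)
  define z where "z = x + (r / 2) *\<^sub>R u"
  have "z = (norm x + r / 2) *\<^sub>R u"
    unfolding z_def scaleR_add_left u(2)[symmetric] ..
  then have nz: "norm z = norm x + r / 2" using u r by simp
  have "dist x z = r / 2" using u r by (simp add: z_def dist_norm)
  then have "ball z (r / 4) \<subseteq> ball x r"
    using r by (intro ball_subset_ball_iff[THEN iffD2]) (simp add: dist_commute)
  \<comment> \<open>As \<open>norm z = norm x + r / 2\<close> with \<open>norm x < 2 * r\<close>,
    the norms on the subball lie between \<open>r / 4\<close> and \<open>11 * r / 4\<close>.\<close>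
  moreover have "norm y \<le> 4 * r \<and> r \<le> 4 * norm y" if "y \<in> ball z (r / 4)" for y
  proof -
    have "norm z - norm y \<le> norm (z - y)" "norm y - norm z \<le> norm (z - y)" "norm (z - y) < r / 4"
      using that norm_triangle_ineq2[of z y] norm_triangle_ineq2[of y z]
      by (auto simp: dist_norm norm_minus_commute)
    then show ?thesis using nz False norm_ge_zero[of x] by linarith
  qed
  ultimately show ?thesis using that[of z] False by auto
qed

text \<open>The upper bound is the transfer applied to the constant function 1, with
  \<open>l = n\<close> and \<open>\<tau> = \<beta>\<close>; its condition is exactly
  \<open>n + \<beta> > 0\<close>. The lower bound keeps only the comparable subball.\<close>

lemma weight_ball_comparable:
  fixes \<beta> :: real
  assumes "- real CARD('n) < \<beta>"
  obtains c where "0 < c"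
    "\<And>(x :: real ^ 'n::finite) r. 0 < r \<Longrightarrow> \<exists>W. weight_measure (power_weight \<beta>) (ball x r) = ennreal W \<and>
       W \<le> c * ball_scale (real CARD('n)) \<beta> x r \<and> ball_scale (real CARD('n)) \<beta> x r \<le> c * W"
proof -
  let ?n = "real CARD('n)"
  define v where "v = unit_ball_vol ?n"
  have v: "0 < v" by (simp add: v_def)
  obtain C where C: "0 < C" and
    transfer: "\<And>(h :: real ^ 'n \<Rightarrow> ennreal) T x r.
       h \<in> borel_measurable lebesgue \<Longrightarrow>
       (\<And>x r. 0 < r \<Longrightarrow> (\<integral>\<^sup>+ y \<in> ball x r. h y \<partial>lebesgue) \<le> ennreal (ball_scale ?n 0 x r) * T) \<Longrightarrow>
       0 < r \<Longrightarrow>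
       (\<integral>\<^sup>+ y \<in> ball x r. h y * ennreal (norm y powr \<beta>) \<partial>lebesgue)
         \<le> ennreal (C * ball_scale ?n (0 + \<beta>) x r) * T"
    using assms by (elim ball_scale_transfer[of ?n 0 \<beta>, rotated]) simp
  define c where "c = max (C * v) (4 powr \<bar>\<beta>\<bar> * 4 ^ CARD('n) / v)"
  show ?thesis
  proof (rule that[of c])
    show "0 < c" using C v by (simp add: c_def less_max_iff_disj)
    fix x :: "real ^ 'n" and r :: real assume r: "0 < r"
    let ?B = "ball_scale ?n \<beta> x r"
    note pos = ball_scale_pos[OF r, of ?n \<beta> x]
    have "weight_measure (power_weight \<beta>) (ball x r) \<le> ennreal (C * ball_scale ?n (0 + \<beta>) x r) * ennreal v"
    proof -
      have "(\<integral>\<^sup>+ y \<in> ball z s. 1 \<partial>lebesgue) \<le> ennreal (ball_scale ?n 0 z s) * ennreal v"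
        if "0 < s" for z :: "real ^ 'n" and s
        using that v by (auto simp: emeasure_ball ball_scale_def powr_realpow v_def mult.commute
            simp flip: ennreal_mult)
      from transfer[OF _ this r, of x] show ?thesis
        by (simp add: weight_measure_def power_weight_def)
    qed
    then have upper: "weight_measure (power_weight \<beta>) (ball x r) \<le> ennreal (C * v * ?B)"
      using C v pos by (simp add: mult_ac flip: ennreal_mult)
    then obtain W where W: "0 \<le> W" "weight_measure (power_weight \<beta>) (ball x r) = ennreal W"
      by (cases "weight_measure (power_weight \<beta>) (ball x r)") (auto simp: top_unique)
    \<comment> \<open>The typical size of the norm on the ball. With it \<open>ball_scale\<close>
      equals \<open>r ^ n * \<mu> powr \<beta>\<close> in both cases.\<close>
    define \<mu> where "\<mu> = (if 2 * r \<le> norm x then norm x else r)"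
    have \<mu>: "0 < \<mu>" using r by (auto simp: \<mu>_def)
    obtain z where z: "ball z (r / 4) \<subseteq> ball x r"
      "\<And>y. y \<in> ball z (r / 4) \<Longrightarrow> norm y \<le> 4 * \<mu> \<and> \<mu> \<le> 4 * norm y"
      using exists_comparable_subball[OF r, of x] unfolding \<mu>_def by blast
    have "ennreal (\<mu> powr \<beta> / 4 powr \<bar>\<beta>\<bar>) * ennreal (v * (r / 4) ^ CARD('n))
        = (\<integral>\<^sup>+ y \<in> ball z (r / 4). ennreal (\<mu> powr \<beta> / 4 powr \<bar>\<beta>\<bar>) \<partial>lebesgue)"
      using r by (simp add: nn_integral_cmult_indicator emeasure_ball v_def)
    also have "\<dots> \<le> (\<integral>\<^sup>+ y \<in> ball x r. ennreal (norm y powr \<beta>) \<partial>lebesgue)"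
    proof (intro nn_integral_mono)
      fix y
      have "\<mu> powr \<beta> / 4 powr \<bar>\<beta>\<bar> \<le> norm y powr \<beta>" if "y \<in> ball z (r / 4)"
      proof -
        have "0 < norm y" using z(2)[OF that] \<mu> by linarith
        then have "\<mu> powr \<beta> \<le> 4 powr \<bar>\<beta>\<bar> * norm y powr \<beta>"
          using z(2)[OF that] \<mu> by (intro powr_le_powr_comparable) auto
        then show ?thesis by (simp add: field_simps)
      qed
      then show "ennreal (\<mu> powr \<beta> / 4 powr \<bar>\<beta>\<bar>) * indicator (ball z (r / 4)) y
          \<le> ennreal (norm y powr \<beta>) * indicator (ball x r) y"
        using z(1) by (auto simp: indicator_def intro!: ennreal_leI)
    qed
    also have "\<dots> = ennreal W"
      using W by (simp add: weight_measure_def power_weight_def)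
    finally have "\<mu> powr \<beta> / 4 powr \<bar>\<beta>\<bar> * (v * (r / 4) ^ CARD('n)) \<le> W"
      using W(1) v r by (subst (asm) ennreal_mult[symmetric]) auto
    moreover have "?B = r ^ CARD('n) * \<mu> powr \<beta>"
      using r by (simp add: ball_scale_def \<mu>_def powr_add powr_realpow)
    ultimately have "?B \<le> 4 powr \<bar>\<beta>\<bar> * 4 ^ CARD('n) / v * W"
      using v by (simp add: field_simps)
    also have "\<dots> \<le> c * W" using W(1) by (intro mult_right_mono) (auto simp: c_def)
    finally have lower: "?B \<le> c * W" .
    have "W \<le> C * v * ?B" using upper W C v pos by (simp add: ennreal_le_iff)
    also have "\<dots> \<le> c * ?B" using pos by (intro mult_right_mono) (auto simp: c_def)
    finally show "\<exists>W. weight_measure (power_weight \<beta>) (ball x r) = ennreal W \<and>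
       W \<le> c * ?B \<and> ?B \<le> c * W" using W lower by blast
  qed
qed

text \<open>Raise the estimate for the weight of a ball to the power \<open>l2 / n\<close> and
  multiply by \<open>r powr l1\<close>: the exponent \<open>n\<close> becomes \<open>l2\<close>, and
  \<open>\<beta>\<close> becomes \<open>\<beta> * l2 / n\<close>. A negative \<open>l2\<close> swaps
  the two bounds.\<close>

lemma scales_like_power_weight:
  fixes \<beta> l1 l2 :: real
  assumes "- real CARD('n) < \<beta>"
  shows "scales_like (l1, l2) (power_weight \<beta> :: real ^ 'n::finite \<Rightarrow> real)
    (l1 + l2) (\<beta> * l2 / real CARD('n))"
proof -
  let ?n = "real CARD('n)"
  define a where "a = l2 / ?n"
  obtain c where c: "0 < c" and W: "\<And>(x :: real ^ 'n) r. 0 < r \<Longrightarrow>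
    \<exists>W. weight_measure (power_weight \<beta>) (ball x r) = ennreal W \<and>
       W \<le> c * ball_scale ?n \<beta> x r \<and> ball_scale ?n \<beta> x r \<le> c * W"
    using weight_ball_comparable[OF assms] by blast
  have scale: "r powr l1 * ball_scale ?n \<beta> x r powr a = ball_scale (l1 + l2) (\<beta> * l2 / ?n) x r"
    if "0 < r" for x :: "real ^ 'n" and r
  proof -
    have "?n * a = l2" "\<beta> * a = \<beta> * l2 / ?n" by (auto simp: a_def)
    then show ?thesis using that
      by (auto simp: ball_scale_def powr_mult powr_powr distrib_right simp flip: powr_add mult.assoc)
         (simp add: algebra_simps)?
  qed
  show ?thesis
    unfolding scales_like_def
  proof (rule exI[of _ "c powr \<bar>a\<bar>"], intro conjI allI impI)
    show "0 < c powr \<bar>a\<bar>" using c by simp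
    fix x :: "real ^ 'n" and r :: real assume r: "0 < r"
    let ?B = "ball_scale ?n \<beta> x r"
    obtain W where W: "weight_measure (power_weight \<beta>) (ball x r) = ennreal W"
        "W \<le> c * ?B" "?B \<le> c * W"
      using W[OF r] by blast
    have B: "0 < ?B" by (rule ball_scale_pos[OF r])
    then have "0 < c * W" using W by linarith
    then have Wpos: "0 < W" using c by (simp add: zero_less_mult_iff)
    let ?d = "r powr l1 * W powr a"
    have "morrey_factor (l1, l2) (power_weight \<beta>) x r = ennreal ?d"
      using Wpos by (simp add: morrey_factor_def W(1) epowr_ennreal a_def ennreal_mult)
    moreover have "?d \<le> r powr l1 * (c powr \<bar>a\<bar> * ?B powr a)"
      using W c B Wpos by (intro mult_left_mono powr_le_powr_comparable) auto
    moreover have "r powr l1 * ?B powr a \<le> r powr l1 * (c powr \<bar>a\<bar> * W powr a)"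
      using W c B Wpos by (intro mult_left_mono powr_le_powr_comparable) auto
    ultimately show "\<exists>d>0. morrey_factor (l1, l2) (power_weight \<beta>) x r = ennreal d \<and>
        d \<le> c powr \<bar>a\<bar> * ball_scale (l1 + l2) (\<beta> * l2 / ?n) x r \<and>
        ball_scale (l1 + l2) (\<beta> * l2 / ?n) x r \<le> c powr \<bar>a\<bar> * d"
      using r Wpos unfolding scale[OF r, symmetric] by (intro exI[of _ ?d]) (auto simp: mult_ac)
  qed
qed

text \<open>By the convention for exponent 0 in \<open>epowr\<close> this holds even when balls have
  infinite weight, as may happen for the weight on the right in (a).\<close>

lemma scales_like_unweighted: "scales_like (l, 0) w l 0"
  unfolding scales_like_def
proof (rule exI[of _ 1], intro conjI allI impI)
  fix x :: "real ^ 'a" and r :: real assume "0 < r"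
  then show "\<exists>d>0. morrey_factor (l, 0) w x r = ennreal d \<and>
      d \<le> 1 * ball_scale l 0 x r \<and> ball_scale l 0 x r \<le> 1 * d"
    by (intro exI[of _ "r powr l"]) (auto simp: morrey_factor_def epowr_def ball_scale_def)
qed simp

section \<open>Comparison of Morrey norms\<close>

text \<open>The alternative \<open>\<tau> = 0\<close>, trivial with constant 1, covers the endpoint
  \<open>l1 + l2 = 0\<close> of (b), where the total exponent vanishes.\<close>

lemma morrey_bound_transfer:
  assumes "0 < m + \<epsilon> + \<tau> \<or> \<tau> = 0"
  obtains C where "0 < C"
    "\<And>(f :: real ^ 'n::finite \<Rightarrow> complex) T. f \<in> borel_measurable lebesgue \<Longrightarrow>
       morrey_bound p (power_weight \<beta>) f m \<epsilon> T \<Longrightarrow>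
       morrey_bound p (power_weight (\<beta> + \<tau>)) f m (\<epsilon> + \<tau>) (ennreal C * T)"
  using assms
proof (elim disjE)
  assume "0 < m + \<epsilon> + \<tau>"
  then obtain C where C: "0 < C" and
    transfer: "\<And>(h :: real ^ 'n \<Rightarrow> ennreal) T x r.
       h \<in> borel_measurable lebesgue \<Longrightarrow>
       (\<And>x r. 0 < r \<Longrightarrow> (\<integral>\<^sup>+ y \<in> ball x r. h y \<partial>lebesgue) \<le> ennreal (ball_scale m \<epsilon> x r) * T) \<Longrightarrow>
       0 < r \<Longrightarrow>
       (\<integral>\<^sup>+ y \<in> ball x r. h y * ennreal (norm y powr \<tau>) \<partial>lebesgue)
         \<le> ennreal (C * ball_scale m (\<epsilon> + \<tau>) x r) * T"
    by (rule ball_scale_transfer) (rule that; blast)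
  show ?thesis
  proof (rule that[OF C])
    fix f :: "real ^ 'n \<Rightarrow> complex" and T
    assume [measurable]: "f \<in> borel_measurable lebesgue"
      and T: "morrey_bound p (power_weight \<beta>) f m \<epsilon> T"
    let ?h = "\<lambda>y. ennreal (norm (f y) powr p * power_weight \<beta> y)"
    have h: "?h \<in> borel_measurable lebesgue"
      unfolding power_weight_def by measurable
    show "morrey_bound p (power_weight (\<beta> + \<tau>)) f m (\<epsilon> + \<tau>) (ennreal C * T)"
      unfolding morrey_bound_def
    proof (intro allI impI)
      fix x :: "real ^ 'n" and r :: real assume r: "0 < r"
      have "?h y * ennreal (norm y powr \<tau>) = ennreal (norm (f y) powr p * power_weight (\<beta> + \<tau>) y)" for y
        by (simp add: power_weight_def powr_add mult_ac flip: ennreal_mult)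
      then have "(\<integral>\<^sup>+ y \<in> ball x r. ennreal (norm (f y) powr p * power_weight (\<beta> + \<tau>) y) \<partial>lebesgue)
          \<le> ennreal (C * ball_scale m (\<epsilon> + \<tau>) x r) * T"
        using transfer[OF h _ r, of T x] T by (simp add: morrey_bound_def)
      also have "\<dots> = ennreal (ball_scale m (\<epsilon> + \<tau>) x r) * (ennreal C * T)"
        using C by (simp add: ennreal_mult' mult_ac)
      finally show "(\<integral>\<^sup>+ y \<in> ball x r. ennreal (norm (f y) powr p * power_weight (\<beta> + \<tau>) y) \<partial>lebesgue)
          \<le> ennreal (ball_scale m (\<epsilon> + \<tau>) x r) * (ennreal C * T)" .
    qed
  qed
qed (use that[of 1] in simp)

text \<open>Pass from the norm to ball bounds, transfer, and return. The p-th power taken first is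
  undone by the final root, so the inequality is linear in the norm.\<close>

lemma morrey_norm_le_of_transfer:
  fixes w w' :: "real ^ 'n::finite \<Rightarrow> real"
  assumes "0 < p" "scales_like l w m \<epsilon>" "scales_like l' w' m' \<epsilon>'" "0 < C"
    and transfer: "\<And>f T. f \<in> borel_measurable lebesgue \<Longrightarrow> morrey_bound p w f m \<epsilon> T \<Longrightarrow>
      morrey_bound p w' f m' \<epsilon>' (ennreal C * T)"
  obtains K where "0 < K"
    "\<And>f. f \<in> borel_measurable lebesgue \<Longrightarrow> morrey_norm p l' w' f \<le> ennreal K * morrey_norm p l w f"
proof -
  obtain C1 where C1: "0 < C1"
    "\<And>f. morrey_bound p w f m \<epsilon> (ennreal C1 * epowr (morrey_norm p l w f) p)"
    using morrey_bound_of_norm[OF assms(2,1)] by blast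
  obtain C2 where C2: "0 < C2"
    "\<And>f T. morrey_bound p w' f m' \<epsilon>' T \<Longrightarrow> morrey_norm p l' w' f \<le> ennreal C2 * epowr T (1 / p)"
    using norm_le_of_morrey_bound[OF assms(3,1)] by blast
  let ?K = "C2 * (C * C1) powr (1 / p)"
  have "morrey_norm p l' w' f \<le> ennreal ?K * morrey_norm p l w f"
    if "f \<in> borel_measurable lebesgue" for f
  proof -
    have "morrey_norm p l' w' f
        \<le> ennreal C2 * epowr (ennreal (C * C1) * epowr (morrey_norm p l w f) p) (1 / p)"
      using C2(2)[OF transfer[OF that C1(2)]] C1 assms(4) by (simp add: ennreal_mult mult.assoc)
    also have "\<dots> = ennreal ?K * morrey_norm p l w f"
      using assms(1,4) C1 C2 by (simp add: powr_mult epowr_cmult epowr_epowr_inverse ennreal_mult mult.assoc)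
    finally show ?thesis .
  qed
  moreover have "0 < ?K" using assms(4) C1 C2 by simp
  ultimately show ?thesis using that by blast
qed

lemma equivalent_normsI:
  assumes "0 < C" "0 < K"
    and "\<And>f. f \<in> borel_measurable lebesgue \<Longrightarrow> M f \<le> ennreal C * N f"
    and "\<And>f. f \<in> borel_measurable lebesgue \<Longrightarrow> N f \<le> ennreal K * M f"
  shows "equivalent_norms N M"
proof -
  have "ennreal (1 / C) * M f \<le> N f" if "f \<in> borel_measurable lebesgue" for f
  proof -
    have "ennreal (1 / C) * M f \<le> ennreal (1 / C) * (ennreal C * N f)"
      using assms that by (intro mult_left_mono) auto
    also have "\<dots> = N f" using assms(1) by (simp add: mult.assoc[symmetric] flip: ennreal_mult)
    finally show ?thesis .
  qed
  then show ?thesis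
    unfolding equivalent_norms_def using assms by (intro exI[of _ "1 / C"] exI[of _ K]) auto
qed

text \<open>Monotone convergence. The radii start at 1 because ball bounds are available for
  positive radii only.\<close>

lemma nn_integral_eq_SUP_balls:
  fixes h :: "'a::euclidean_space \<Rightarrow> ennreal"
  assumes [measurable]: "h \<in> borel_measurable lebesgue"
  shows "(\<integral>\<^sup>+ y. h y \<partial>lebesgue) = (SUP k. \<integral>\<^sup>+ y \<in> ball 0 (real (Suc k)). h y \<partial>lebesgue)"
proof -
  have "h y = (SUP k. h y * indicator (ball 0 (real (Suc k))) y)" for y
  proof (intro antisym SUP_least)
    obtain k where "norm y < real k" using reals_Archimedean2 by blast
    then have "h y \<le> h y * indicator (ball 0 (real (Suc k))) y" by simp
    then show "h y \<le> (SUP k. h y * indicator (ball 0 (real (Suc k))) y)"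
      by (rule SUP_upper2[OF UNIV_I])
  qed (auto simp: indicator_def)
  then have "(\<integral>\<^sup>+ y. h y \<partial>lebesgue)
      = (\<integral>\<^sup>+ y. (SUP k. h y * indicator (ball 0 (real (Suc k))) y) \<partial>lebesgue)"
    by simp
  also have "\<dots> = (SUP k. \<integral>\<^sup>+ y \<in> ball 0 (real (Suc k)). h y \<partial>lebesgue)"
  proof (intro nn_integral_monotone_convergence_SUP)
    show "(\<lambda>y. h y * indicator (ball 0 (real (Suc k))) y) \<in> borel_measurable lebesgue" for k
      by measurable
  qed (auto simp: incseq_def le_fun_def indicator_def)
  finally show ?thesis .
qed

text \<open>Taking the power \<open>\<epsilon>\<close> out of the weight leaves total exponent
  \<open>l1 + l2\<close>; putting it back gives \<open>l1 + l2 + \<epsilon>\<close>. Each positivity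
  assumption serves one direction. The result is used for (a) and, with \<open>l1 + l2 = n\<close>,
  for (d).\<close>

lemma equivalent_norms_subcritical:
  fixes p \<beta> l1 l2 :: real
  defines "n \<equiv> real CARD('n::finite)"
  assumes "0 < p" "- n < \<beta>" "0 < l1 + l2 * (1 + \<beta> / n)" "0 < l1 + l2"
  shows "equivalent_norms (morrey_norm p (l1, l2) (power_weight \<beta> :: real ^ 'n \<Rightarrow> real))
    (morrey_norm p (l1 + l2, 0) (power_weight (\<beta> * (1 - l2 / n))))"
proof -
  define \<epsilon> where "\<epsilon> = \<beta> * l2 / n"
  have weight: "\<beta> * (1 - l2 / n) = \<beta> + - \<epsilon>" by (simp add: \<epsilon>_def algebra_simps)
  have pos: "0 < l1 + l2 + \<epsilon>" using assms(4) by (simp add: \<epsilon>_def algebra_simps)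
  have s1: "scales_like (l1, l2) (power_weight \<beta> :: real ^ 'n \<Rightarrow> real) (l1 + l2) \<epsilon>"
    using scales_like_power_weight[where 'n = 'n] assms unfolding \<epsilon>_def n_def by blast
  have s2: "scales_like (l1 + l2, 0) (power_weight (\<beta> + - \<epsilon>) :: real ^ 'n \<Rightarrow> real) (l1 + l2) 0"
    by (rule scales_like_unweighted)
  obtain C where C: "0 < C"
    "\<And>(f :: real ^ 'n \<Rightarrow> complex) T. f \<in> borel_measurable lebesgue \<Longrightarrow>
       morrey_bound p (power_weight \<beta>) f (l1 + l2) \<epsilon> T \<Longrightarrow>
       morrey_bound p (power_weight (\<beta> + - \<epsilon>)) f (l1 + l2) (\<epsilon> + - \<epsilon>) (ennreal C * T)"
    using assms by (elim morrey_bound_transfer[of "l1 + l2" \<epsilon> "- \<epsilon>", rotated]) simp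
  obtain C' where C': "0 < C'"
    "\<And>(f :: real ^ 'n \<Rightarrow> complex) T. f \<in> borel_measurable lebesgue \<Longrightarrow>
       morrey_bound p (power_weight (\<beta> + - \<epsilon>)) f (l1 + l2) 0 T \<Longrightarrow>
       morrey_bound p (power_weight (\<beta> + - \<epsilon> + \<epsilon>)) f (l1 + l2) (0 + \<epsilon>) (ennreal C' * T)"
    using pos by (elim morrey_bound_transfer[of "l1 + l2" 0 \<epsilon>, rotated]) simp
  obtain K where K: "0 < K" "\<And>f :: real ^ 'n \<Rightarrow> complex. f \<in> borel_measurable lebesgue \<Longrightarrow>
      morrey_norm p (l1 + l2, 0) (power_weight (\<beta> + - \<epsilon>)) f
        \<le> ennreal K * morrey_norm p (l1, l2) (power_weight \<beta>) f"
    by (rule morrey_norm_le_of_transfer[OF assms(2) s1 s2 C(1)]) (use C(2) in auto)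
  obtain K' where K': "0 < K'" "\<And>f :: real ^ 'n \<Rightarrow> complex. f \<in> borel_measurable lebesgue \<Longrightarrow>
      morrey_norm p (l1, l2) (power_weight \<beta>) f
        \<le> ennreal K' * morrey_norm p (l1 + l2, 0) (power_weight (\<beta> + - \<epsilon>)) f"
    by (rule morrey_norm_le_of_transfer[OF assms(2) s2 s1 C'(1)]) (use C'(2) in auto)
  show ?thesis unfolding weight by (rule equivalent_normsI[OF K(1) K'(1)]) (use K K' in auto)
qed

text \<open>Now \<open>\<epsilon> = - m\<close>, so removing the power \<open>m\<close> from the
  weight would lead to total exponent 0, where the dyadic series diverges. The Morrey term therefore
  controls only balls away from the origin, and the global integral takes over the rest.\<close>

lemma equivalent_norms_critical:
  fixes p \<beta> l1 l2 :: real
  defines "n \<equiv> real CARD('n::finite)"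
  assumes p: "0 < p" and "- n < \<beta>" and crit: "l1 + l2 * (1 + \<beta> / n) = 0" and "0 \<le> l1 + l2"
  shows "equivalent_norms (morrey_norm p (l1, l2) (power_weight \<beta> :: real ^ 'n \<Rightarrow> real))
    (\<lambda>f. weighted_Lp_norm p (power_weight \<beta>) f +
       morrey_norm p (l1 + l2, 0) (power_weight (\<beta> + l1 + l2)) f)"
proof -
  define m where "m = l1 + l2"
  let ?w = "power_weight \<beta> :: real ^ 'n \<Rightarrow> real"
  let ?w' = "power_weight (\<beta> + m) :: real ^ 'n \<Rightarrow> real"
  have "\<beta> * l2 / n = - m" using crit by (simp add: m_def algebra_simps)
  then have s1: "scales_like (l1, l2) ?w m (- m)"
    using scales_like_power_weight[where 'n = 'n, of \<beta> l1 l2] assms unfolding m_def n_def by simp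
  have s2: "scales_like (m, 0) ?w' m 0"
    by (rule scales_like_unweighted)
  have meas: "(\<lambda>y. ennreal (norm (f y) powr p * power_weight \<gamma> y)) \<in> borel_measurable lebesgue"
    if [measurable]: "f \<in> borel_measurable lebesgue" for f :: "real ^ 'n \<Rightarrow> complex" and \<gamma>
    unfolding power_weight_def by measurable
  obtain C where C: "0 < C"
    "\<And>(f :: real ^ 'n \<Rightarrow> complex) T. f \<in> borel_measurable lebesgue \<Longrightarrow>
       morrey_bound p ?w f m (- m) T \<Longrightarrow> morrey_bound p ?w' f m (- m + m) (ennreal C * T)"
    using assms(5) by (elim morrey_bound_transfer[of m "- m" m, rotated]) (auto simp: m_def)
  obtain K where K: "0 < K" "\<And>f :: real ^ 'n \<Rightarrow> complex. f \<in> borel_measurable lebesgue \<Longrightarrow>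
      morrey_norm p (m, 0) ?w' f \<le> ennreal K * morrey_norm p (l1, l2) ?w f"
    by (rule morrey_norm_le_of_transfer[OF p s1 s2 C(1)]) (use C(2) in auto)
  obtain C1 where C1: "0 < C1"
    "\<And>f. morrey_bound p ?w f m (- m) (ennreal C1 * epowr (morrey_norm p (l1, l2) ?w f) p)"
    using morrey_bound_of_norm[OF s1 p] by blast
  have Lp: "weighted_Lp_norm p ?w f \<le> ennreal (C1 powr (1 / p)) * morrey_norm p (l1, l2) ?w f"
    if f: "f \<in> borel_measurable lebesgue" for f
  proof -
    let ?N = "morrey_norm p (l1, l2) ?w f"
    have "(\<integral>\<^sup>+ y. ennreal (norm (f y) powr p * ?w y) \<partial>lebesgue) \<le> ennreal C1 * epowr ?N p"
      unfolding nn_integral_eq_SUP_balls[OF meas[OF f]]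
    proof (rule SUP_least)
      \<comment> \<open>For a ball centred at 0 the scale is \<open>r powr 0 = 1\<close>, so the
        bound is the same for every radius.\<close>
      fix k
      show "(\<integral>\<^sup>+ y \<in> ball 0 (real (Suc k)). ennreal (norm (f y) powr p * ?w y) \<partial>lebesgue)
          \<le> ennreal C1 * epowr ?N p"
        using C1(2)[of f, unfolded morrey_bound_def, rule_format, of "real (Suc k)" 0]
        by (simp add: ball_scale_def)
    qed
    then have "weighted_Lp_norm p ?w f \<le> epowr (ennreal C1 * epowr ?N p) (1 / p)"
      unfolding weighted_Lp_norm_def using p by (intro epowr_mono) auto
    then show ?thesis using C1 p by (simp add: epowr_cmult epowr_epowr_inverse)
  qed
  obtain C2 where C2: "0 < C2"
    "\<And>f. morrey_bound p ?w' f m 0 (ennreal C2 * epowr (morrey_norm p (m, 0) ?w' f) p)"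
    using morrey_bound_of_norm[OF s2 p] by blast
  obtain C3 where C3: "0 < C3"
    "\<And>f T. morrey_bound p ?w f m (- m) T \<Longrightarrow> morrey_norm p (l1, l2) ?w f \<le> ennreal C3 * epowr T (1 / p)"
    using norm_le_of_morrey_bound[OF s1 p] by blast
  \<comment> \<open>The entry 1 is for balls near the origin, bounded by the whole integral; the
    other is the cost of \<open>small_ball_integral_le\<close> on distant balls.\<close>
  define D where "D = max 1 (2 powr \<bar>m\<bar> * C2)"
  have D: "0 < D" by (simp add: D_def)
  have upper: "morrey_norm p (l1, l2) ?w f \<le> ennreal (C3 * D powr (1 / p)) *
      (weighted_Lp_norm p ?w f + morrey_norm p (m, 0) ?w' f)"
    if f: "f \<in> borel_measurable lebesgue" for f
  proof -
    define M where "M = weighted_Lp_norm p ?w f + morrey_norm p (m, 0) ?w' f"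
    have "morrey_bound p ?w f m (- m) (ennreal D * epowr M p)"
      unfolding morrey_bound_def
    proof (intro allI impI)
      fix x :: "real ^ 'n" and r :: real assume r: "0 < r"
      let ?I = "\<integral>\<^sup>+ y \<in> ball x r. ennreal (norm (f y) powr p * ?w y) \<partial>lebesgue"
      show "?I \<le> ennreal (ball_scale m (- m) x r) * (ennreal D * epowr M p)"
      proof (cases "2 * r \<le> norm x")
        case True
        have "?I = (\<integral>\<^sup>+ y \<in> ball x r. ennreal (norm (f y) powr p * ?w' y) * ennreal (norm y powr - m) \<partial>lebesgue)"
          by (simp add: power_weight_def mult.assoc flip: ennreal_mult powr_add)
        also have "\<dots> \<le> ennreal (2 powr \<bar>- m\<bar> * norm x powr - m) *
            (\<integral>\<^sup>+ y \<in> ball x r. ennreal (norm (f y) powr p * ?w' y) \<partial>lebesgue)"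
          by (rule small_ball_integral_le[OF meas[OF f] r True])
        also have "\<dots> \<le> ennreal (2 powr \<bar>- m\<bar> * norm x powr - m) *
            (ennreal (ball_scale m 0 x r) * (ennreal C2 * epowr (morrey_norm p (m, 0) ?w' f) p))"
          using C2(2)[of f] r by (intro mult_left_mono) (auto simp: morrey_bound_def)
        also have "\<dots> = ennreal (2 powr \<bar>m\<bar> * norm x powr - m * ball_scale m 0 x r * C2)
            * epowr (morrey_norm p (m, 0) ?w' f) p"
          using ball_scale_pos[OF r, of m 0 x] C2(1) by (simp add: ennreal_mult mult.assoc)
        also have "2 powr \<bar>m\<bar> * norm x powr - m * ball_scale m 0 x r * C2
            = ball_scale m (- m) x r * (2 powr \<bar>m\<bar> * C2)"
          using True r by (auto simp: ball_scale_def)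
        also have "ennreal \<dots> * epowr (morrey_norm p (m, 0) ?w' f) p
            \<le> ennreal (ball_scale m (- m) x r * D) * epowr M p"
          using ball_scale_pos[OF r, of m "- m" x] p
          by (intro mult_mono ennreal_leI mult_left_mono epowr_mono) (auto simp: D_def M_def)
        also have "\<dots> = ennreal (ball_scale m (- m) x r) * (ennreal D * epowr M p)"
          using ball_scale_pos[OF r, of m "- m" x] D by (simp add: ennreal_mult mult.assoc)
        finally show ?thesis .
      next
        case False
        have "?I \<le> (\<integral>\<^sup>+ y. ennreal (norm (f y) powr p * ?w y) \<partial>lebesgue)"
          by (intro nn_integral_mono) (auto simp: indicator_def)
        also have "\<dots> = epowr (weighted_Lp_norm p ?w f) p"
          using p by (simp add: weighted_Lp_norm_def epowr_inverse_epowr)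
        also have "\<dots> \<le> epowr M p" using p by (intro epowr_mono) (auto simp: M_def)
        also have "\<dots> = 1 * epowr M p" by simp
        also have "\<dots> \<le> ennreal D * epowr M p" by (intro mult_right_mono) (auto simp: D_def)
        finally show ?thesis using False r by (simp add: ball_scale_def)
      qed
    qed
    then have "morrey_norm p (l1, l2) ?w f \<le> ennreal C3 * epowr (ennreal D * epowr M p) (1 / p)"
      by (rule C3(2))
    also have "\<dots> = ennreal (C3 * D powr (1 / p)) * M"
      using p D C3 by (simp add: epowr_cmult epowr_epowr_inverse ennreal_mult mult.assoc)
    finally show ?thesis unfolding M_def .
  qed
  have lower: "weighted_Lp_norm p ?w f + morrey_norm p (m, 0) ?w' f
      \<le> ennreal (C1 powr (1 / p) + K) * morrey_norm p (l1, l2) ?w f"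
    if "f \<in> borel_measurable lebesgue" for f
    using add_mono[OF Lp[OF that] K(2)[OF that]] K(1) by (simp add: distrib_right)
  have eq: "\<beta> + l1 + l2 = \<beta> + m" by (simp add: m_def)
  have "0 < C1 powr (1 / p) + K" "0 < C3 * D powr (1 / p)"
    using K(1) C3(1) D by (auto intro: add_nonneg_pos)
  then show ?thesis
    unfolding eq m_def[symmetric] by (rule equivalent_normsI) (use lower upper in auto)
qed

section \<open>Triviality of the space for negative total exponent\<close>

lemma ae_class_cong: "AE x in lebesgue. f x = g x \<Longrightarrow> ae_class f = ae_class g"
  unfolding ae_class_def by (auto elim: AE_mp intro: AE_mp[rotated] AE_I2)

lemma AE_lebesgue_neq_0: "AE x::'a::euclidean_space in lebesgue. x \<noteq> 0"
  by (rule AE_I'[of "{0}"]) (auto simp: negligible_iff_null_sets[symmetric])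

text \<open>The integral over a fixed centred ball is at most that over a ball of radius
  \<open>j\<close>, which is bounded by a finite constant times a negative power of
  \<open>j\<close>.\<close>

lemma morrey_space_trivial:
  fixes p \<beta> l1 l2 :: real
  defines "n \<equiv> real CARD('n::finite)"
  assumes p: "0 < p" and "- n < \<beta>" and neg: "l1 + l2 * (1 + \<beta> / n) < 0"
  shows "morrey_space p (l1, l2) (power_weight \<beta> :: real ^ 'n \<Rightarrow> real) = {ae_class (\<lambda>_. 0)}"
proof -
  let ?w = "power_weight \<beta> :: real ^ 'n \<Rightarrow> real"
  let ?\<epsilon> = "\<beta> * l2 / n"
  have neg: "l1 + l2 + ?\<epsilon> < 0" using neg by (simp add: algebra_simps)
  have "scales_like (l1, l2) ?w (l1 + l2) ?\<epsilon>"
    using scales_like_power_weight[where 'n = 'n] assms unfolding n_def by blast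
  then obtain C where C: "0 < C"
    "\<And>f. morrey_bound p ?w f (l1 + l2) ?\<epsilon> (ennreal C * epowr (morrey_norm p (l1, l2) ?w f) p)"
    using morrey_bound_of_norm[OF _ p] by blast
  have "AE x in lebesgue. f x = 0"
    if f [measurable]: "f \<in> borel_measurable lebesgue" and fin: "morrey_norm p (l1, l2) ?w f < \<infinity>" for f
  proof -
    define h where "h y = ennreal (norm (f y) powr p * ?w y)" for y
    have h: "h \<in> borel_measurable lebesgue"
      unfolding h_def power_weight_def by measurable
    obtain t where t: "0 \<le> t" "ennreal C * epowr (morrey_norm p (l1, l2) ?w f) p = ennreal t"
      using epowr_less_top[OF p fin] by (cases "ennreal C * epowr (morrey_norm p (l1, l2) ?w f) p")
        (auto simp: ennreal_mult_eq_top_iff)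
    have "(\<integral>\<^sup>+ y \<in> ball 0 (real (Suc k)). h y \<partial>lebesgue) \<le> 0" for k
    proof (rule LIMSEQ_le_const)
      have "(\<lambda>j. real j powr (l1 + l2 + ?\<epsilon>) * t) \<longlonglongrightarrow> 0 * t"
        using neg by (intro tendsto_intros tendsto_neg_powr filterlim_real_sequentially)
      then show "(\<lambda>j. ennreal (real j powr (l1 + l2 + ?\<epsilon>) * t)) \<longlonglongrightarrow> 0"
        using tendsto_ennrealI by fastforce
      have "(\<integral>\<^sup>+ y \<in> ball 0 (real (Suc k)). h y \<partial>lebesgue) \<le> ennreal (real j powr (l1 + l2 + ?\<epsilon>) * t)"
        if "Suc k \<le> j" for j
      proof -
        have "(\<integral>\<^sup>+ y \<in> ball 0 (real (Suc k)). h y \<partial>lebesgue) \<le> (\<integral>\<^sup>+ y \<in> ball 0 (real j). h y \<partial>lebesgue)"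
          using that by (intro nn_integral_mono) (auto simp: indicator_def)
        also have "\<dots> \<le> ennreal (ball_scale (l1 + l2) ?\<epsilon> (0 :: real ^ 'n) (real j)) * ennreal t"
          using C(2)[of f] that t(2) by (simp add: morrey_bound_def h_def)
        finally show ?thesis using that t(1) by (simp add: ball_scale_def flip: ennreal_mult)
      qed
      then show "\<exists>N. \<forall>j\<ge>N. (\<integral>\<^sup>+ y \<in> ball 0 (real (Suc k)). h y \<partial>lebesgue)
          \<le> ennreal (real j powr (l1 + l2 + ?\<epsilon>) * t)" by blast
    qed
    then have "(\<integral>\<^sup>+ y. h y \<partial>lebesgue) = 0"
      unfolding nn_integral_eq_SUP_balls[OF h] by (simp add: SUP_le_iff bot_ennreal)
    then have "AE y in lebesgue. h y = 0"
      using h by (simp add: nn_integral_0_iff_AE)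
    \<comment> \<open>The origin is excluded because the weight is 0 there by convention and says
      nothing about \<open>f\<close>.\<close>
    then show ?thesis using AE_lebesgue_neq_0
      by eventually_elim (auto simp: h_def power_weight_def ennreal_eq_0_iff mult_le_0_iff)
  qed
  moreover have "morrey_norm p (l1, l2) ?w (\<lambda>_. 0) < \<infinity>"
    using p by (simp add: morrey_norm_def epowr_def)
  ultimately show ?thesis
    unfolding morrey_space_def by (auto intro!: image_eqI ae_class_cong)
qed

section \<open>Bounded averages over balls\<close>

text \<open>Vitali's theorem fills \<open>U\<close> up to a null set with countably many disjoint
  balls inside \<open>U\<close>, over which the ball estimates add up.\<close>

lemma open_integral_le_of_balls:
  fixes h :: "'a::euclidean_space \<Rightarrow> ennreal"
  assumes h [measurable]: "h \<in> borel_measurable lebesgue"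
    and balls: "\<And>x r. 0 < r \<Longrightarrow>
      (\<integral>\<^sup>+ y \<in> ball x r. h y \<partial>lebesgue) \<le> c * emeasure lebesgue (ball x r)"
    and U: "open U"
  shows "(\<integral>\<^sup>+ y \<in> U. h y \<partial>lebesgue) \<le> c * emeasure lebesgue U"
proof -
  let ?\<nu> = "density lebesgue h"
  define K where "K = {(x :: 'a, r). 0 < r \<and> ball x r \<subseteq> U}"
  \<comment> \<open>The fineness that Vitali's theorem asks for: each point of \<open>U\<close> lies
    in arbitrarily small balls of the family.\<close>
  have "\<exists>i. i \<in> K \<and> x \<in> ball (fst i) (snd i) \<and> snd i < d" if x: "x \<in> U" and d: "0 < d" for x d
  proof -
    obtain e where e: "0 < e" "ball x e \<subseteq> U" using U x openE by blast
    define s where "s = min e (d / 2)"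
    have "0 < s" "s < d" "ball x s \<subseteq> ball x e"
      using e d by (auto simp: s_def intro!: subset_ball)
    then show ?thesis
      using e by (intro exI[of _ "(x, s)"]) (auto simp: K_def)
  qed
  then obtain D where D: "countable D" "D \<subseteq> K"
    "pairwise (\<lambda>i j. disjnt (ball (fst i) (snd i)) (ball (fst j) (snd j))) D"
    "negligible (U - (\<Union>i\<in>D. ball (fst i) (snd i)))"
    by (rule Vitali_covering_theorem_balls)
  define V where "V = (\<Union>i\<in>D. ball (fst i) (snd i))"
  have disj: "disjoint_family_on (\<lambda>i. ball (fst i) (snd i)) D"
    using D(3) by (auto simp: disjoint_family_on_def pairwise_def disjnt_def)
  have V [measurable]: "V \<in> sets lebesgue" and U_meas [measurable]: "U \<in> sets lebesgue"
    using open_UN[of D "\<lambda>i. ball (fst i) (snd i)"] U by (auto simp: V_def intro!: sets_completionI_sets)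
  have "U - V \<in> null_sets lebesgue"
    using D(4) by (simp add: V_def negligible_iff_null_sets)
  then have null: "U - V \<in> null_sets ?\<nu>"
    using absolutely_continuousI_density[OF h] by (auto simp: absolutely_continuous_def)
  have "(\<integral>\<^sup>+ y \<in> U. h y \<partial>lebesgue) = emeasure ?\<nu> U"
    by (simp add: emeasure_density)
  also have "\<dots> \<le> emeasure ?\<nu> (V \<union> (U - V))"
    by (intro emeasure_mono) auto
  also have "\<dots> = emeasure ?\<nu> V"
    using null by (intro emeasure_Un_null_set) auto
  also have "\<dots> = (\<integral>\<^sup>+ i. emeasure ?\<nu> (ball (fst i) (snd i)) \<partial>count_space D)"
    unfolding V_def using D(1) disj by (intro emeasure_UN_countable) auto
  also have "\<dots> \<le> (\<integral>\<^sup>+ i. c * emeasure lebesgue (ball (fst i) (snd i)) \<partial>count_space D)"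
    using D(2) balls by (intro nn_integral_mono) (auto simp: emeasure_density K_def)
  also have "\<dots> = c * (\<integral>\<^sup>+ i. emeasure lebesgue (ball (fst i) (snd i)) \<partial>count_space D)"
    by (rule nn_integral_cmult) simp
  also have "(\<integral>\<^sup>+ i. emeasure lebesgue (ball (fst i) (snd i)) \<partial>count_space D) = emeasure lebesgue V"
    unfolding V_def using D(1) disj by (intro emeasure_UN_countable[symmetric]) auto
  also have "c * emeasure lebesgue V \<le> c * emeasure lebesgue U"
  proof (intro mult_left_mono emeasure_mono)
    have "ball (fst i) (snd i) \<subseteq> U" if "i \<in> D" for i
      using subsetD[OF D(2) that] by (simp add: K_def case_prod_beta)
    then show "V \<subseteq> U" unfolding V_def by blast
  qed simp_all
  finally show ?thesis .
qed

text \<open>If \<open>h \<ge> q > c\<close> on a bounded set of measure \<open>a\<close>, an open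
  set of barely larger measure gives \<open>q * a \<le> c * a\<close> up to an arbitrarily small
  error, hence \<open>a = 0\<close>.\<close>

lemma AE_le_of_ball_integrals:
  fixes h :: "'a::euclidean_space \<Rightarrow> ennreal" and c :: real
  assumes h [measurable]: "h \<in> borel_measurable lebesgue" and c: "0 \<le> c"
    and balls: "\<And>x r. 0 < r \<Longrightarrow>
      (\<integral>\<^sup>+ y \<in> ball x r. h y \<partial>lebesgue) \<le> ennreal c * emeasure lebesgue (ball x r)"
  shows "AE y in lebesgue. h y \<le> ennreal c"
proof -
  have null: "AE y in lebesgue. \<not> (y \<in> ball 0 (real k) \<and> ennreal q \<le> h y)" if q: "c < q" for q k
  proof -
    \<comment> \<open>Intersecting with a ball makes the measure of \<open>E\<close> a real number,
      so it can be cancelled later.\<close>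
    define E where "E = {y \<in> ball 0 (real k). ennreal q \<le> h y}"
    have E [measurable]: "E \<in> sets lebesgue"
    proof -
      have "E = ball 0 (real k) \<inter> {y \<in> space lebesgue. ennreal q \<le> h y}" by (auto simp: E_def)
      then show ?thesis by simp
    qed
    have "emeasure lebesgue E \<le> emeasure lebesgue (ball (0 :: 'a) (real k))"
      by (intro emeasure_mono) (auto simp: E_def)
    also have "\<dots> < \<infinity>" by (simp add: emeasure_ball)
    finally obtain a where a: "0 \<le> a" "emeasure lebesgue E = ennreal a"
      by (cases "emeasure lebesgue E") auto
    have "q * a \<le> c * a + e" if e: "0 < e" for e
    proof -
      \<comment> \<open>The denominator is \<open>c + 1\<close> because \<open>c\<close> may be
        0.\<close>
      define e' where "e' = e / (c + 1)"
      have e': "0 < e'" "c * e' \<le> e"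
        using c e by (auto simp: e'_def field_simps)
      obtain U where U: "open U" "E \<subseteq> U" "U - E \<in> lmeasurable" "emeasure lebesgue (U - E) < ennreal e'"
        using sets_lebesgue_outer_open[OF E e'(1)] by blast
      have [measurable]: "U \<in> sets lebesgue" using U(1) by (auto intro: sets_completionI_sets)
      have "ennreal q * ennreal a = (\<integral>\<^sup>+ y \<in> E. ennreal q \<partial>lebesgue)"
        by (simp only: a(2)[symmetric] nn_integral_cmult_indicator[OF E])
      also have "\<dots> \<le> (\<integral>\<^sup>+ y \<in> U. h y \<partial>lebesgue)"
        using U(2) by (intro nn_integral_mono) (auto simp: E_def indicator_def)
      also have "\<dots> \<le> ennreal c * emeasure lebesgue U"
        by (rule open_integral_le_of_balls[OF h balls U(1)])
      also have "emeasure lebesgue U \<le> emeasure lebesgue E + emeasure lebesgue (U - E)"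
        using U(2) emeasure_subadditive[of E lebesgue "U - E"] by (simp add: Un_absorb1)
      also have "\<dots> \<le> ennreal a + ennreal e'"
        using a U(4) by (intro add_mono) auto
      finally have "ennreal (q * a) \<le> ennreal (c * (a + e'))"
        using q c a e' by (simp add: ennreal_mult mult_left_mono)
      then have "q * a \<le> c * (a + e')"
        using c a e' by (subst (asm) ennreal_le_iff) auto
      then show ?thesis using e' by (simp add: distrib_left)
    qed
    then have "q * a \<le> c * a" by (rule field_le_epsilon)
    then have "a = 0" using q a(1) mult_strict_right_mono[of c q a] by linarith
    then have "E \<in> null_sets lebesgue" using a(2) by auto
    then show ?thesis by (rule AE_I'[rotated 0]) (auto simp: E_def)
  qed
  \<comment> \<open>Countably many radii and thresholds \<open>c + 1 / Suc j\<close> suffice to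
    cover the set where \<open>h\<close> exceeds \<open>c\<close>.\<close>
  have "AE y in lebesgue. \<forall>k j. \<not> (y \<in> ball 0 (real k) \<and> ennreal (c + 1 / real (Suc j)) \<le> h y)"
    unfolding AE_all_countable by (intro allI null) simp
  then show ?thesis
  proof eventually_elim
    case (elim y)
    obtain k where k: "norm y < real k" using reals_Archimedean2 by blast
    show ?case
    proof (rule ennreal_le_epsilon)
      fix e :: real assume "0 < e"
      then obtain j where j: "1 / real (Suc j) < e" by (rule nat_approx_posE)
      have "h y \<le> ennreal (c + 1 / real (Suc j))" using elim[rule_format, of k j] k by simp
      also have "\<dots> \<le> ennreal (c + e)" using j by (intro ennreal_leI) simp
      also have "\<dots> = ennreal c + ennreal e" using c \<open>0 < e\<close> by simp
      finally show "h y \<le> ennreal c + ennreal e" .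
    qed
  qed
qed

text \<open>For \<open>l = n\<close> and \<open>\<epsilon> = 0\<close> the scale is the volume of
  the ball divided by that of the unit ball. Finiteness of the norm thus says that the averages of
  the weighted p-th power are bounded.\<close>

lemma morrey_norm_finite_iff_Linfty:
  fixes f :: "real ^ 'n::finite \<Rightarrow> complex"
  assumes p: "0 < p" and f [measurable]: "f \<in> borel_measurable lebesgue"
  shows "morrey_norm p (real CARD('n), 0) (power_weight \<gamma>) f < \<infinity> \<longleftrightarrow>
    (\<lambda>x. norm (f x) powr p * power_weight \<gamma> x) \<in> Linfty"
proof -
  let ?n = "real CARD('n)"
  let ?g = "\<lambda>x. norm (f x) powr p * power_weight \<gamma> x"
  define v where "v = unit_ball_vol ?n"
  have v: "0 < v" by (simp add: v_def)
  have scale: "ennreal (ball_scale ?n 0 x r) * ennreal v = emeasure lebesgue (ball x r)"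
    if "0 < r" for x :: "real ^ 'n" and r
    using that v by (simp add: emeasure_ball ball_scale_def powr_realpow v_def mult.commute flip: ennreal_mult)
  have g [measurable]: "?g \<in> borel_measurable lebesgue"
    unfolding power_weight_def by measurable
  have abs_g: "\<bar>?g x\<bar> = ?g x" for x by (simp add: power_weight_def)
  have s: "scales_like (?n, 0) (power_weight \<gamma> :: real ^ 'n \<Rightarrow> real) ?n 0"
    by (rule scales_like_unweighted)
  show ?thesis
  proof
    assume fin: "morrey_norm p (?n, 0) (power_weight \<gamma>) f < \<infinity>"
    obtain C where "0 < C" and C: "morrey_bound p (power_weight \<gamma>) f ?n 0
        (ennreal C * epowr (morrey_norm p (?n, 0) (power_weight \<gamma>) f) p)"
      using morrey_bound_of_norm[OF s p] by blast
    obtain t where t: "0 \<le> t" "ennreal C * epowr (morrey_norm p (?n, 0) (power_weight \<gamma>) f) p = ennreal t"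
      using epowr_less_top[OF p fin]
      by (cases "ennreal C * epowr (morrey_norm p (?n, 0) (power_weight \<gamma>) f) p")
        (auto simp: ennreal_mult_eq_top_iff)
    have "AE y in lebesgue. ennreal (?g y) \<le> ennreal (t / v)"
    proof (rule AE_le_of_ball_integrals)
      fix x :: "real ^ 'n" and r :: real assume r: "0 < r"
      have "(\<integral>\<^sup>+ y \<in> ball x r. ennreal (?g y) \<partial>lebesgue) \<le> ennreal (ball_scale ?n 0 x r) * ennreal t"
        using C r by (simp add: morrey_bound_def t(2))
      also have "\<dots> = ennreal (t / v) * (ennreal (ball_scale ?n 0 x r) * ennreal v)"
        using v t(1) ball_scale_pos[OF r, of ?n 0 x] by (simp flip: ennreal_mult)
      finally show "(\<integral>\<^sup>+ y \<in> ball x r. ennreal (?g y) \<partial>lebesgue)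
          \<le> ennreal (t / v) * emeasure lebesgue (ball x r)"
        unfolding scale[OF r] .
    qed (use t v in auto)
    then have "esssup lebesgue (\<lambda>x. ennreal \<bar>?g x\<bar>) \<le> ennreal (t / v)"
      unfolding abs_g by (intro esssup_I) auto
    then show "?g \<in> Linfty"
      unfolding Linfty_def by (auto intro: order.strict_trans1)
  next
    assume "?g \<in> Linfty"
    then have fin: "esssup lebesgue (\<lambda>x. ennreal (?g x)) < \<infinity>"
      unfolding Linfty_def mem_Collect_eq abs_g by blast
    define M where "M = esssup lebesgue (\<lambda>x. ennreal (?g x))"
    have AE: "AE x in lebesgue. ennreal (?g x) \<le> M" unfolding M_def by (rule esssup_AE)
    have bound: "morrey_bound p (power_weight \<gamma>) f ?n 0 (ennreal v * M)"
      unfolding morrey_bound_def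
    proof (intro allI impI)
      fix x :: "real ^ 'n" and r :: real assume r: "0 < r"
      have "(\<integral>\<^sup>+ y \<in> ball x r. ennreal (?g y) \<partial>lebesgue) \<le> (\<integral>\<^sup>+ y \<in> ball x r. M \<partial>lebesgue)"
        using AE by (intro nn_integral_mono_AE) (auto elim!: eventually_mono simp: indicator_def)
      also have "\<dots> = M * emeasure lebesgue (ball x r)"
        by (intro nn_integral_cmult_indicator) simp
      also have "\<dots> = ennreal (ball_scale ?n 0 x r) * (ennreal v * M)"
        by (simp only: scale[OF r, symmetric] mult_ac)
      finally show "(\<integral>\<^sup>+ y \<in> ball x r. ennreal (?g y) \<partial>lebesgue)
          \<le> ennreal (ball_scale ?n 0 x r) * (ennreal v * M)" .
    qed
    obtain C where C: "0 < C" "\<And>(f :: real ^ 'n \<Rightarrow> complex) T. morrey_bound p (power_weight \<gamma>) f ?n 0 T \<Longrightarrow>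
        morrey_norm p (?n, 0) (power_weight \<gamma>) f \<le> ennreal C * epowr T (1 / p)"
      using norm_le_of_morrey_bound[OF s p] by blast
    have "morrey_norm p (?n, 0) (power_weight \<gamma>) f
        \<le> ennreal C * epowr (ennreal v * M) (1 / p)" by (rule C(2)[OF bound])
    also have "\<dots> < \<infinity>"
      using epowr_less_top[of "1 / p" "ennreal v * M"] p fin
      by (simp add: M_def ennreal_mult_less_top)
    finally show "morrey_norm p (?n, 0) (power_weight \<gamma>) f < \<infinity>" .
  qed
qed

section \<open>Assembly of the four cases\<close>

lemma equivalent_norms_finite_iff:
  assumes "equivalent_norms N M" "f \<in> borel_measurable lebesgue"
  shows "N f < \<infinity> \<longleftrightarrow> M f < \<infinity>"
proof -
  obtain c C where "0 < c" "ennreal c * M f \<le> N f" "N f \<le> ennreal C * M f"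
    using assms unfolding equivalent_norms_def by blast
  moreover have "ennreal C * M f < \<infinity>" if "M f < \<infinity>"
    using that by (simp add: ennreal_mult_less_top)
  moreover have "M f < \<infinity>" if "ennreal c * M f < \<infinity>"
    using that \<open>0 < c\<close> by (auto simp: ennreal_mult_less_top)
  ultimately show ?thesis
    by (meson order.strict_trans1)
qed

theorem proposition2p10:
  fixes p l1 l2 \<beta> n :: real
  assumes n: "n = real CARD('n::finite)"
    and p: "0 < p" and \<beta>: "\<beta> > - n"
  shows
    "(l1 + l2 * (1 + \<beta> / n) > 0 \<and> 0 < l1 + l2 \<and> l1 + l2 < n \<longrightarrow>
       equivalent_norms
         (morrey_norm p (l1, l2) (power_weight \<beta> :: real ^ 'n \<Rightarrow> real))
         (morrey_norm p (l1 + l2, 0) (power_weight (\<beta> * (1 - l2 / n))))) \<and>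
     (l1 + l2 * (1 + \<beta> / n) = 0 \<and> 0 \<le> l1 + l2 \<and> l1 + l2 < n \<longrightarrow>
       equivalent_norms
         (morrey_norm p (l1, l2) (power_weight \<beta> :: real ^ 'n \<Rightarrow> real))
         (\<lambda>f. weighted_Lp_norm p (power_weight \<beta>) f +
              morrey_norm p (l1 + l2, 0) (power_weight (\<beta> + l1 + l2)) f)) \<and>
     (l1 + l2 * (1 + \<beta> / n) < 0 \<longrightarrow>
       morrey_space p (l1, l2) (power_weight \<beta> :: real ^ 'n \<Rightarrow> real) =
         {ae_class (\<lambda>_. 0)}) \<and>
     (n = l1 + l2 \<and> l1 + l2 > - (l2 * \<beta> / n) \<longrightarrow>
       morrey_space p (l1, l2) (power_weight \<beta> :: real ^ 'n \<Rightarrow> real) =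
         ae_class ` {f \<in> borel_measurable lebesgue.
           (\<lambda>x. norm (f x) powr p * power_weight (\<beta> * (1 - l2 / n)) x) \<in> Linfty})"
proof (intro conjI impI)
  assume "l1 + l2 * (1 + \<beta> / n) > 0 \<and> 0 < l1 + l2 \<and> l1 + l2 < n"
  then show "equivalent_norms
         (morrey_norm p (l1, l2) (power_weight \<beta> :: real ^ 'n \<Rightarrow> real))
         (morrey_norm p (l1 + l2, 0) (power_weight (\<beta> * (1 - l2 / n))))"
    using equivalent_norms_subcritical[where 'n = 'n] p \<beta> unfolding n by blast
next
  assume "l1 + l2 * (1 + \<beta> / n) = 0 \<and> 0 \<le> l1 + l2 \<and> l1 + l2 < n"
  then show "equivalent_norms
         (morrey_norm p (l1, l2) (power_weight \<beta> :: real ^ 'n \<Rightarrow> real))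
         (\<lambda>f. weighted_Lp_norm p (power_weight \<beta>) f +
              morrey_norm p (l1 + l2, 0) (power_weight (\<beta> + l1 + l2)) f)"
    using equivalent_norms_critical[where 'n = 'n] p \<beta> unfolding n by blast
next
  assume "l1 + l2 * (1 + \<beta> / n) < 0"
  then show "morrey_space p (l1, l2) (power_weight \<beta> :: real ^ 'n \<Rightarrow> real) = {ae_class (\<lambda>_. 0)}"
    using morrey_space_trivial[where 'n = 'n] p \<beta> unfolding n by blast
next
  assume crit: "n = l1 + l2 \<and> l1 + l2 > - (l2 * \<beta> / n)"
  \<comment> \<open>With \<open>l1 + l2 = n > 0\<close>, the remaining condition in (d) is exactly
    the positivity of \<open>l1 + l2 * (1 + \<beta> / n)\<close>, so the comparison behind (a)
    applies.\<close>
  have "0 < n" by (simp add: n)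
  then have "equivalent_norms (morrey_norm p (l1, l2) (power_weight \<beta> :: real ^ 'n \<Rightarrow> real))
      (morrey_norm p (l1 + l2, 0) (power_weight (\<beta> * (1 - l2 / n))))"
    using crit p \<beta> unfolding n
    by (intro equivalent_norms_subcritical) (auto simp: algebra_simps)
  moreover have "l1 + l2 = real CARD('n)" using crit n by simp
  ultimately have "morrey_norm p (l1, l2) (power_weight \<beta>) f < \<infinity> \<longleftrightarrow>
      (\<lambda>x. norm (f x) powr p * power_weight (\<beta> * (1 - l2 / n)) x) \<in> Linfty"
    if "f \<in> borel_measurable lebesgue" for f :: "real ^ 'n \<Rightarrow> complex"
    using equivalent_norms_finite_iff[OF _ that] morrey_norm_finite_iff_Linfty[OF p that] by metis
  then show "morrey_space p (l1, l2) (power_weight \<beta> :: real ^ 'n \<Rightarrow> real) =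
         ae_class ` {f \<in> borel_measurable lebesgue.
           (\<lambda>x. norm (f x) powr p * power_weight (\<beta> * (1 - l2 / n)) x) \<in> Linfty}"
    unfolding morrey_space_def by (intro arg_cong[where f = "image ae_class"]) blast
qed

end
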